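(* Let $q$ be a prime power, $m>1$ an integer, and let $A$ (of length $n_A$) and $B$ (of length $n_B$) be supplementary codes obtained from a partition of the columns of $H_m$. If $A$ is completely transitive with dimension $n_A-m$ and covering radius $\rho(A)=2$, then the supplementary code $B$ is also completely transitive.
   Context: $\mathbb{F}_q$ is the finite field of order $q$; $d(\cdot,\cdot)$ is the Hamming distance on $\mathbb{F}_q^n$. The covering radius of $C\subset\mathbb{F}_q^n$ is $\rho(C)=\max_{\mathbf v\in\mathbb{F}_q^n}\min_{\mathbf x\in C}d(\mathbf v,\mathbf x)$. For a linear code $C\subset\mathbb{F}_q^n$, $\mathrm{Aut}(C)$ is the group of all maps $\mathbb{F}_q^n\to\mathbb{F}_q^n$ that preserve $C$ and are a composition of a monomial map $\mathbf x\mapsto \mathbf xM$ ($M$ an $n\times n$ matrix over $\mathbb{F}_q$ with exactly one nonzero entry in each row and column) and a field automorphism of $\mathbb{F}_q$ applied coordinatewise (for $q$ prime only monomial maps occur). It acts on the cosets of $C$ by $\pi(\mathbf v+C)=\pi(\mathbf v)+C$. A linear code $C$ with covering radius $\rho$ is completely transitive if $\mathrm{Aut}(C)$ has exactly $\rho+1$ orbits on the set of cosets of $C$. Let $H_m$ be an $m\times n$ matrix over $\mathbb{F}_q$, $n=(q^m-1)/(q-1)$, whose columns form a maximal set of pairwise linearly independent vectors of $\mathbb{F}_q^m$ (a parity-check matrix of the $q$-ary Hamming code $\mathcal H_m$). Choose a non-empty subset of $n_A<n$ columns of $H_m$, let $H_A$ be the submatrix formed by them, and let $H_B$ be the submatrix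 formed by the remaining $n_B=n-n_A$ columns. The codes $A=\{\mathbf x\in\mathbb{F}_q^{n_A}:H_A\mathbf x^T=\mathbf 0^T\}$ and $B=\{\mathbf x\in\mathbb{F}_q^{n_B}:H_B\mathbf x^T=\mathbf 0^T\}$ are called supplementary to each other. *)

theory Defs
  imports
    "HOL-Library.Cardinality"
    "HOL-Algebra.AbelCoset"
    "HOL-Algebra.Group_Action"
    "Jordan_Normal_Form.DL_Submatrix"
    "Jordan_Normal_Form.Matrix_Kernel"
begin

text \<open>
  The field \<open>F_q\<close> is a type \<open>'a\<close> of class \<open>{field, finite}\<close>, so \<open>q = CARD('a)\<close>; the space \<open>F_q^n\<close> is
  \<^term>\<open>carrier_vec n\<close>, and a code of length \<open>n\<close> is a subset of it.
\<close>

definition hamming_dist :: "'a vec \<Rightarrow> 'a vec \<Rightarrow> nat" where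
  "hamming_dist v x = card {i. i < dim_vec v \<and> v $ i \<noteq> x $ i}"

definition covering_radius :: "nat \<Rightarrow> 'a::{field,finite} vec set \<Rightarrow> nat" where
  "covering_radius n C = Max ((\<lambda>v. Min (hamming_dist v ` C)) ` carrier_vec n)"

definition linear_code :: "nat \<Rightarrow> 'a::field vec set \<Rightarrow> bool" where
  "linear_code n C \<longleftrightarrow> subspace class_ring C (module_vec TYPE('a) n)"

definition monomial_mat :: "nat \<Rightarrow> 'a::field mat \<Rightarrow> bool" where
  "monomial_mat n M \<longleftrightarrow> M \<in> carrier_mat n n
     \<and> (\<forall>i<n. \<exists>!j. j < n \<and> M $$ (i, j) \<noteq> 0)
     \<and> (\<forall>j<n. \<exists>!i. i < n \<and> M $$ (i, j) \<noteq> 0)"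

definition field_automorphism :: "('a::field \<Rightarrow> 'a) \<Rightarrow> bool" where
  "field_automorphism \<sigma> \<longleftrightarrow> field_hom \<sigma> \<and> bij \<sigma>"

text \<open>
  Vectors are columns here, so the row vector \<open>xM\<close> is written \<open>M\<^sup>T *\<^sub>v x\<close>.  As
  \<open>\<sigma>(xM) = \<sigma>(x) \<sigma>(M)\<close> and \<open>\<sigma>(M)\<close> is again monomial, composing in the other order yields the
  same set of maps.  The maps are restricted to \<^term>\<open>carrier_vec n\<close>, so that equality of elements
  is equality as maps on \<open>F_q^n\<close>, as \<^const>\<open>BijGroup\<close> requires.
\<close>
definition semilinear_monomial_maps :: "nat \<Rightarrow> ('a::field vec \<Rightarrow> 'a vec) set" where
  "semilinear_monomial_maps n =
     {\<lambda>x \<in> carrier_vec n. map_vec \<sigma> (transpose_mat M *\<^sub>v x) | \<sigma> M.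
        field_automorphism \<sigma> \<and> monomial_mat n M}"

definition Aut_code :: "nat \<Rightarrow> 'a::field vec set \<Rightarrow> ('a vec \<Rightarrow> 'a vec) monoid" where
  "Aut_code n C =
     BijGroup (carrier_vec n) \<lparr>carrier := {\<pi> \<in> semilinear_monomial_maps n. \<pi> ` C = C}\<rparr>"

definition code_cosets :: "nat \<Rightarrow> 'a::field vec set \<Rightarrow> 'a vec set set" where
  "code_cosets n C = A_RCOSETS (module_vec TYPE('a) n) C"

text \<open>
  The elements of \<^term>\<open>Aut_code n C\<close> are additive and preserve \<open>C\<close>, so \<open>\<pi>(v) + C\<close> is the image of
  the coset \<open>v + C\<close> under \<open>\<pi>\<close>.
\<close>
definition completely_transitive :: "nat \<Rightarrow> 'a::{field,finite} vec set \<Rightarrow> bool" where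
  "completely_transitive n C \<longleftrightarrow> linear_code n C
     \<and> card (orbits (Aut_code n C) (code_cosets n C) (\<lambda>\<pi> K. \<pi> ` K)) = covering_radius n C + 1"

text \<open>
  The case \<open>u = v\<close> is included on purpose: it says that \<open>S\<close> does not contain the zero vector, which
  would otherwise be allowed in a singleton \<open>S\<close>.
\<close>
definition pairwise_lin_indpt :: "nat \<Rightarrow> 'a::field vec set \<Rightarrow> bool" where
  "pairwise_lin_indpt m S \<longleftrightarrow> S \<subseteq> carrier_vec m
     \<and> (\<forall>u\<in>S. \<forall>v\<in>S. \<not> module.lin_dep class_ring (module_vec TYPE('a) m) {u, v})"

definition hamming_check_mat :: "nat \<Rightarrow> 'a::{field,finite} mat \<Rightarrow> bool" where
  "hamming_check_mat m H \<longleftrightarrow>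
     H \<in> carrier_mat m ((CARD('a) ^ m - 1) div (CARD('a) - 1))
     \<and> distinct (cols H)
     \<and> maximal (set (cols H)) (pairwise_lin_indpt m)"

text \<open>The submatrix formed by the columns with (0-based) index in \<open>J\<close>, in their original order.\<close>
abbreviation cols_submat :: "'a mat \<Rightarrow> nat set \<Rightarrow> 'a mat" where
  "cols_submat H J \<equiv> submatrix H UNIV J"

end

theory Submission
  imports Defs
begin

text \<open>
  A coset of a kernel code \<open>ker H\<close> is determined by its syndrome, so everything can be read off in
  the syndrome space \<open>F\<^sup>m\<close>.  The cosets of weight 0 and 1 are those whose syndrome is zero,
  respectively a nonzero multiple of a column of \<open>H\<close>.  As every nonzero vector of \<open>F\<^sup>m\<close> is
  a multiple of exactly one column of the Hamming matrix, \<open>F\<^sup>m\<close> is the disjoint union of \<open>{0}\<close>,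
  the multiples \<open>P_A\<close> of the columns of \<open>H_A\<close> and the multiples \<open>P_B\<close> of those of \<open>H_B\<close>.

  The dimension hypothesis makes \<open>H_A\<close> surjective, so all of \<open>F\<^sup>m\<close> occurs as syndromes of
  \<open>A\<close>, and since \<open>\<rho>(A) = 2\<close> the three parts are exactly the syndromes of the cosets of \<open>A\<close> of
  weight 0, 1 and 2.  An automorphism of \<open>A\<close> induces a semilinear bijection \<open>\<phi>\<close> of \<open>F\<^sup>m\<close>
  (\<open>Aut_code_induces_syndrome_map\<close>); automorphisms preserve coset weights, so \<open>\<phi>\<close> preserves
  \<open>P_A\<close> and hence also \<open>P_B\<close>.  A semilinear bijection that preserves \<open>P_B\<close> permutes the columns
  of \<open>H_B\<close> up to scalars and therefore comes from an automorphism of \<open>B\<close>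
  (\<open>syndrome_map_lifts_to_Aut_code\<close>).  So the group acting on the syndromes is handed over from
  \<open>A\<close> to \<open>B\<close>.

  To conclude, complete transitivity is reformulated without counting: it says that cosets of equal
  weight lie in one orbit (\<open>completely_transitive_iff\<close>).  If two cosets of \<open>B\<close> have equal weight,
  their syndromes lie in the same one of the three parts; hence the cosets of \<open>A\<close> with these
  syndromes have equal weight, some automorphism of \<open>A\<close> maps one to the other, and the
  automorphism of \<open>B\<close> with the same \<open>\<phi>\<close> does so for the cosets of \<open>B\<close>.  This covers the case
  where the columns of \<open>H_B\<close> span a proper subspace, with \<open>\<rho>(B) = 1\<close>, together with the case
  \<open>\<rho>(B) = 2\<close>.
\<close>

section \<open>Weights of cosets\<close>

definition hamming_weight :: "'a::zero vec \<Rightarrow> nat" where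
  "hamming_weight x = card {i. i < dim_vec x \<and> x $ i \<noteq> 0}"

definition coset_weight :: "'a::zero vec set \<Rightarrow> nat" where
  "coset_weight K = Min (hamming_weight ` K)"

abbreviation coset :: "'a::plus vec set \<Rightarrow> 'a vec \<Rightarrow> 'a vec set" where
  "coset C v \<equiv> (\<lambda>h. h + v) ` C"

lemma finite_carrier_vec: "finite (carrier_vec n :: 'a::finite vec set)"
proof (rule finite_surj)
  show "finite {xs :: 'a list. set xs \<subseteq> UNIV \<and> length xs = n}"
    by (rule finite_lists_length_eq) simp
  show "carrier_vec n \<subseteq> vec_of_list ` {xs :: 'a list. set xs \<subseteq> UNIV \<and> length xs = n}"
  proof
    fix v :: "'a vec" assume "v \<in> carrier_vec n"
    then show "v \<in> vec_of_list ` {xs. set xs \<subseteq> UNIV \<and> length xs = n}"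
      by (intro image_eqI[of _ _ "list_of_vec v"]) (auto simp: vec_list)
  qed
qed

lemma hamming_weight_eq_0_iff:
  assumes "x \<in> carrier_vec n"
  shows "hamming_weight x = 0 \<longleftrightarrow> x = 0\<^sub>v n"
  using assms unfolding hamming_weight_def by (auto simp: vec_eq_iff)

lemma hamming_weight_zero_vec [simp]: "hamming_weight (0\<^sub>v n) = 0"
  by (simp add: hamming_weight_eq_0_iff[of _ n])

text \<open>
  Splitting off one nonzero coordinate.  This is the induction step both for moving from a coset to
  one of smaller weight and for checking semilinear maps on the unit vectors only.
\<close>
lemma hamming_weight_SucE:
  fixes x :: "'a::field vec"
  assumes x: "x \<in> carrier_vec n" and w: "hamming_weight x = Suc w"
  obtains y c i where "i < n" "c \<noteq> 0" "y \<in> carrier_vec n" "hamming_weight y = w"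
    "x = y + c \<cdot>\<^sub>v unit_vec n i"
proof -
  have "{i. i < dim_vec x \<and> x $ i \<noteq> 0} \<noteq> {}"
    using w unfolding hamming_weight_def by (metis card.empty nat.distinct(1))
  then obtain i where i: "i < n" "x $ i \<noteq> 0" using x by auto
  let ?y = "x - x $ i \<cdot>\<^sub>v unit_vec n i"
  have "{j. j < dim_vec x \<and> x $ j \<noteq> 0} = insert i {j. j < dim_vec ?y \<and> ?y $ j \<noteq> 0}"
    using i x by (auto simp: unit_vec_def split: if_splits)
  moreover have "i \<notin> {j. j < dim_vec ?y \<and> ?y $ j \<noteq> 0}" using i x by auto
  ultimately have "hamming_weight ?y = w"
    using w unfolding hamming_weight_def by simp
  moreover have "x = ?y + x $ i \<cdot>\<^sub>v unit_vec n i" using x by auto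
  ultimately show thesis using that[of i "x $ i" ?y] i x by auto
qed

lemma hamming_weight_add_unit_le:
  fixes z :: "'a::field vec"
  assumes z: "z \<in> carrier_vec n"
  shows "hamming_weight (z + c \<cdot>\<^sub>v unit_vec n i) \<le> Suc (hamming_weight z)"
proof -
  have "hamming_weight (z + c \<cdot>\<^sub>v unit_vec n i) \<le> card (insert i {j. j < dim_vec z \<and> z $ j \<noteq> 0})"
    unfolding hamming_weight_def using z
    by (intro card_mono) (auto simp: unit_vec_def split: if_splits)
  also have "\<dots> \<le> Suc (hamming_weight z)"
    unfolding hamming_weight_def by (simp add: card_insert_if)
  finally show ?thesis .
qed

lemma coset_weight_leader:
  fixes K :: "'a::{zero,finite} vec set"
  assumes "K \<subseteq> carrier_vec n" "K \<noteq> {}"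
  obtains x where "x \<in> K" "hamming_weight x = coset_weight K"
proof -
  have "coset_weight K \<in> hamming_weight ` K"
    unfolding coset_weight_def using assms finite_subset[OF _ finite_carrier_vec] by (intro Min_in) auto
  then show thesis using that by auto
qed

lemma coset_weight_le:
  fixes K :: "'a::{zero,finite} vec set"
  assumes "K \<subseteq> carrier_vec n" "x \<in> K"
  shows "coset_weight K \<le> hamming_weight x"
  unfolding coset_weight_def using assms finite_subset[OF _ finite_carrier_vec] by (intro Min_le) auto

lemma linear_codeD:
  fixes C :: "'a::field vec set"
  assumes "linear_code n C"
  shows "C \<subseteq> carrier_vec n" "0\<^sub>v n \<in> C" "\<And>x y. x \<in> C \<Longrightarrow> y \<in> C \<Longrightarrow> x + y \<in> C"
    "\<And>c x. x \<in> C \<Longrightarrow> c \<cdot>\<^sub>v x \<in> C"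
proof -
  interpret submodule class_ring C "module_vec TYPE('a) n"
    using assms unfolding linear_code_def subspace_def by auto
  show C: "C \<subseteq> carrier_vec n" using subset by (simp add: module_vec_simps)
  show "0\<^sub>v n \<in> C" "\<And>x y. x \<in> C \<Longrightarrow> y \<in> C \<Longrightarrow> x + y \<in> C" "\<And>c x. x \<in> C \<Longrightarrow> c \<cdot>\<^sub>v x \<in> C"
    using zero_closed m_closed smult_closed by (auto simp: module_vec_simps class_ring_simps)
qed

lemma linear_code_kernel:
  fixes H :: "'a::field mat"
  assumes H: "H \<in> carrier_mat m n"
  shows "linear_code n (mat_kernel H)"
proof -
  interpret kernel m n H by unfold_locales (rule H)
  have "submodule class_ring (mat_kernel H) (module_vec TYPE('a) n)"
    by unfold_locales
      (insert mult_add_distrib_mat_vec[OF H] mult_mat_vec[OF H] mat_kernel[OF H],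
       auto simp: class_ring_simps module_vec_simps)
  then show ?thesis unfolding linear_code_def subspace_def using vec_vs by auto
qed

lemma code_cosets_eq: "code_cosets n C = coset C ` carrier_vec n"
  unfolding code_cosets_def A_RCOSETS_def' a_r_coset_def' module_vec_simps by auto

lemma coset_eq_if_mem:
  fixes C :: "'a::field vec set"
  assumes C: "linear_code n C" and v: "v \<in> carrier_vec n" and x: "x \<in> coset C v"
  shows "coset C x = coset C v"
proof -
  note D = linear_codeD[OF C]
  obtain h where h: "h \<in> C" "x = h + v" using x by auto
  have hc: "h \<in> carrier_vec n" using h D by auto
  show ?thesis
  proof (intro equalityI subsetI)
    fix y assume "y \<in> coset C x"
    then obtain k where k: "k \<in> C" "y = k + x" by auto
    have "y = (k + h) + v" using k h hc v D(1) by auto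
    then show "y \<in> coset C v" using D(3)[OF k(1) h(1)] by blast
  next
    fix y assume "y \<in> coset C v"
    then obtain k where k: "k \<in> C" "y = k + v" by auto
    have "y = (k + (-1) \<cdot>\<^sub>v h) + x" using k h hc v D(1) by (auto simp: vec_eq_iff)
    then show "y \<in> coset C x" using D(3)[OF k(1) D(4)[OF h(1), of "-1"]] by blast
  qed
qed

lemma coset_subset:
  fixes C :: "'a::field vec set"
  assumes "linear_code n C" "v \<in> carrier_vec n"
  shows "coset C v \<subseteq> carrier_vec n" "v \<in> coset C v"
proof -
  show "coset C v \<subseteq> carrier_vec n" using linear_codeD(1)[OF assms(1)] assms(2) by auto
  show "v \<in> coset C v" 
    using linear_codeD(2)[OF assms(1)] assms(2) by (intro image_eqI[of _ _ "0\<^sub>v n"]) auto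
qed

text \<open>
  As \<open>C = -C\<close>, the distances from \<open>v\<close> to \<open>C\<close> are the weights of the vectors in \<open>v + C\<close>.
\<close>
lemma hamming_weight_coset:
  fixes C :: "'a::field vec set"
  assumes C: "linear_code n C" and v: "v \<in> carrier_vec n"
  shows "hamming_weight ` coset C v = hamming_dist v ` C"
proof -
  note D = linear_codeD[OF C]
  have eq: "hamming_weight (h + v) = hamming_dist v ((-1) \<cdot>\<^sub>v h)" if "h \<in> C" for h
  proof -
    have "h \<in> carrier_vec n" using that D by auto
    then have "{i. i < dim_vec (h + v) \<and> (h + v) $ i \<noteq> 0} =
               {i. i < dim_vec v \<and> v $ i \<noteq> ((-1) \<cdot>\<^sub>v h) $ i}"
      using v by (auto simp: add_eq_0_iff)
    then show ?thesis unfolding hamming_weight_def hamming_dist_def by simp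
  qed
  have "(\<lambda>h. (-1) \<cdot>\<^sub>v h) ` C = C"
  proof (intro equalityI subsetI)
    fix h assume h: "h \<in> C"
    have "h = (-1) \<cdot>\<^sub>v ((-1) \<cdot>\<^sub>v h)" by (auto simp: vec_eq_iff)
    then show "h \<in> (\<lambda>h. (-1) \<cdot>\<^sub>v h) ` C" using D(4)[OF h] by blast
  qed (use D in auto)
  moreover have "hamming_weight ` coset C v = hamming_dist v ` ((\<lambda>h. (-1) \<cdot>\<^sub>v h) ` C)"
    unfolding image_image using eq by auto
  ultimately show ?thesis by simp
qed

lemma covering_radius_eq:
  fixes C :: "'a::{field,finite} vec set"
  assumes "linear_code n C"
  shows "covering_radius n C = Max (coset_weight ` code_cosets n C)"
proof -
  have "(\<lambda>v. Min (hamming_dist v ` C)) ` carrier_vec n = (\<lambda>v. coset_weight (coset C v)) ` carrier_vec n"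
    unfolding coset_weight_def using hamming_weight_coset[OF assms] by (intro image_cong) auto
  then show ?thesis unfolding covering_radius_def code_cosets_eq by (simp add: image_image)
qed

text \<open>
  Deleting a nonzero coordinate from a leader of the coset lowers its weight by one, and no vector of
  the new coset can be lighter, since restoring the coordinate adds at most one to the weight.
\<close>
lemma coset_weight_pred:
  fixes C :: "'a::{field,finite} vec set"
  assumes C: "linear_code n C" and K: "K \<in> code_cosets n C" and w: "coset_weight K = Suc w"
  shows "\<exists>L\<in>code_cosets n C. coset_weight L = w"
proof -
  obtain v where v: "v \<in> carrier_vec n" "K = coset C v" using K unfolding code_cosets_eq by auto
  note KK = coset_subset[OF C v(1), folded v(2)]
  obtain x where x: "x \<in> K" "hamming_weight x = Suc w" using coset_weight_leader[OF KK(1)] KK(2) w by force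
  have xc: "x \<in> carrier_vec n" using x KK by auto
  obtain y c i where y: "i < n" "y \<in> carrier_vec n" "hamming_weight y = w" "x = y + c \<cdot>\<^sub>v unit_vec n i"
    using hamming_weight_SucE[OF xc x(2)] by metis
  note LL = coset_subset[OF C y(2)]
  have KL: "z + c \<cdot>\<^sub>v unit_vec n i \<in> K" if z: "z \<in> coset C y" for z
  proof -
    obtain h where h: "h \<in> C" "z = h + y" using z by blast
    have "z + c \<cdot>\<^sub>v unit_vec n i = h + x" using h y linear_codeD(1)[OF C] by auto
    then show ?thesis using coset_eq_if_mem[OF C v(1)] x v h by auto
  qed
  obtain z where z: "z \<in> coset C y" "hamming_weight z = coset_weight (coset C y)"
    using coset_weight_leader[OF LL(1)] LL(2) by blast
  have "Suc w \<le> Suc (hamming_weight z)"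
    using coset_weight_le[OF KK(1) KL[OF z(1)]] hamming_weight_add_unit_le[of z n c i] z LL w by force
  moreover have "coset_weight (coset C y) \<le> w" using coset_weight_le[OF LL] y by simp
  ultimately have "coset_weight (coset C y) = w" using z by simp
  then show ?thesis using y unfolding code_cosets_eq by auto
qed

text \<open>
  The covering radius is the largest coset weight, and descending from it by
  \<open>coset_weight_pred\<close> skips no weight.
\<close>
lemma coset_weights:
  fixes C :: "'a::{field,finite} vec set"
  assumes C: "linear_code n C"
  shows "coset_weight ` code_cosets n C = {..covering_radius n C}"
proof -
  let ?S = "coset_weight ` code_cosets n C"
  have fin: "finite ?S" unfolding code_cosets_eq by (simp add: finite_carrier_vec)
  have ne: "?S \<noteq> {}" unfolding code_cosets_eq by (auto intro: zero_carrier_vec)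
  have "k \<in> ?S" if "k \<le> Max ?S" for k
    using that Max_in[OF fin ne]
  proof (induction k rule: inc_induct)
    case (step w)
    then obtain K where "K \<in> code_cosets n C" "coset_weight K = Suc w" by (metis imageE)
    then show ?case using coset_weight_pred[OF C] by blast
  qed
  then show ?thesis unfolding covering_radius_eq[OF C] using Max_ge[OF fin] by blast
qed

lemma coset_weight_le_covering_radius:
  fixes C :: "'a::{field,finite} vec set"
  assumes "linear_code n C" "K \<in> code_cosets n C"
  shows "coset_weight K \<le> covering_radius n C"
  using coset_weights[OF assms(1)] assms(2) by blast

section \<open>Semilinear maps\<close>

definition semilinear_map :: "('a::field \<Rightarrow> 'a) \<Rightarrow> nat \<Rightarrow> nat \<Rightarrow> ('a vec \<Rightarrow> 'a vec) \<Rightarrow> bool" where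
  "semilinear_map \<sigma> n m f \<longleftrightarrow> field_automorphism \<sigma>
     \<and> (\<forall>x\<in>carrier_vec n. f x \<in> carrier_vec m)
     \<and> (\<forall>x\<in>carrier_vec n. \<forall>y\<in>carrier_vec n. f (x + y) = f x + f y)
     \<and> (\<forall>c. \<forall>x\<in>carrier_vec n. f (c \<cdot>\<^sub>v x) = \<sigma> c \<cdot>\<^sub>v f x)"

lemma semilinear_mapD:
  assumes "semilinear_map \<sigma> n m f"
  shows "field_automorphism \<sigma>" "x \<in> carrier_vec n \<Longrightarrow> f x \<in> carrier_vec m"
    "x \<in> carrier_vec n \<Longrightarrow> y \<in> carrier_vec n \<Longrightarrow> f (x + y) = f x + f y"
    "x \<in> carrier_vec n \<Longrightarrow> f (c \<cdot>\<^sub>v x) = \<sigma> c \<cdot>\<^sub>v f x"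
  using assms unfolding semilinear_map_def by auto

lemma field_automorphismD:
  assumes "field_automorphism \<sigma>"
  shows "\<sigma> (x + y) = \<sigma> x + \<sigma> y" "\<sigma> (x * y) = \<sigma> x * \<sigma> y" "\<sigma> 0 = 0" "\<sigma> 1 = 1" "\<sigma> x = 0 \<longleftrightarrow> x = 0"
    "bij \<sigma>"
proof -
  interpret field_hom \<sigma> using assms unfolding field_automorphism_def by auto
  show "\<sigma> (x + y) = \<sigma> x + \<sigma> y" "\<sigma> (x * y) = \<sigma> x * \<sigma> y" "\<sigma> 0 = 0" "\<sigma> 1 = 1" "\<sigma> x = 0 \<longleftrightarrow> x = 0"
    by (auto simp: hom_add hom_mult)
  show "bij \<sigma>" using assms unfolding field_automorphism_def by auto
qed

lemma semilinear_map_zero: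
  assumes "semilinear_map \<sigma> n m f"
  shows "f (0\<^sub>v n) = 0\<^sub>v m"
proof -
  note D = semilinear_mapD[OF assms]
  have "f (0\<^sub>v n) = f (0 \<cdot>\<^sub>v 0\<^sub>v n)"
    by (rule arg_cong[of _ _ f]) (simp add: vec_eq_iff)
  also have "\<dots> = 0 \<cdot>\<^sub>v f (0\<^sub>v n)" using D(4) field_automorphismD(3)[OF D(1)] by simp
  also have "\<dots> = 0\<^sub>v m" using D(2)[of "0\<^sub>v n"] by (auto simp: vec_eq_iff)
  finally show ?thesis .
qed

lemma semilinear_map_inj_on:
  assumes f: "semilinear_map \<sigma> n m f"
    and ker: "\<And>x. x \<in> carrier_vec n \<Longrightarrow> f x = 0\<^sub>v m \<Longrightarrow> x = 0\<^sub>v n"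
  shows "inj_on f (carrier_vec n)"
proof (rule inj_onI)
  note D = semilinear_mapD[OF f]
  fix x y assume x: "x \<in> carrier_vec n" and y: "y \<in> carrier_vec n" and eq: "f x = f y"
  have "x = (x - y) + y" using x y by auto
  then have "f x = f (x - y) + f y" using D(3)[of "x - y" y] x y by simp
  then have "f (x - y) = 0\<^sub>v m" using eq D(2)[of "x - y"] D(2)[OF y] x y
    by (auto simp: vec_eq_iff)
  then have "x - y = 0\<^sub>v n" using ker[of "x - y"] x y by auto
  then show "x = y" using x y by (auto simp: vec_eq_iff)
qed

text \<open>
  Additivity and homogeneity determine a semilinear map by its values on the unit vectors; the
  induction over the Hamming weight replaces expanding \<open>x\<close> as a sum of vectors.
\<close>
lemma semilinear_map_eqI:
  assumes f: "semilinear_map \<sigma> n m f" and g: "semilinear_map \<sigma> n m g"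
    and eq: "\<And>i. i < n \<Longrightarrow> f (unit_vec n i) = g (unit_vec n i)"
    and x: "x \<in> carrier_vec n"
  shows "f x = g x"
  using x
proof (induction "hamming_weight x" arbitrary: x)
  case 0
  then show ?case using hamming_weight_eq_0_iff semilinear_map_zero[OF f] semilinear_map_zero[OF g] by metis
next
  case (Suc w)
  note F = semilinear_mapD[OF f] and G = semilinear_mapD[OF g]
  obtain y c i where y: "i < n" "y \<in> carrier_vec n" "hamming_weight y = w" "x = y + c \<cdot>\<^sub>v unit_vec n i"
    using hamming_weight_SucE[OF Suc.prems Suc.hyps(2)[symmetric]] by metis
  show ?case unfolding y(4) using F(3)[of y "c \<cdot>\<^sub>v unit_vec n i"] G(3)[of y "c \<cdot>\<^sub>v unit_vec n i"]
    F(4)[of "unit_vec n i" c] G(4)[of "unit_vec n i" c] eq[OF y(1)] y Suc.hyps(1)[of y] by simp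
qed

section \<open>Monomial maps and the automorphism group\<close>

abbreviation semilinear_monomial :: "nat \<Rightarrow> ('a::field \<Rightarrow> 'a) \<Rightarrow> 'a mat \<Rightarrow> 'a vec \<Rightarrow> 'a vec" where
  "semilinear_monomial n \<sigma> M \<equiv> \<lambda>x \<in> carrier_vec n. map_vec \<sigma> (transpose_mat M *\<^sub>v x)"

lemma semilinear_monomial_semilinear:
  assumes \<sigma>: "field_automorphism \<sigma>" and M: "M \<in> carrier_mat n n"
  shows "semilinear_map \<sigma> n n (semilinear_monomial n \<sigma> M)"
proof -
  note D = field_automorphismD[OF \<sigma>]
  have T: "transpose_mat M \<in> carrier_mat n n" using M by simp
  show ?thesis
    unfolding semilinear_map_def using \<sigma> M T
    by (auto simp: mult_add_distrib_mat_vec[OF T] mult_mat_vec[OF T] D(1,2) vec_eq_iff)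
qed

text \<open>
  Coordinate \<open>j\<close> of the image is a nonzero multiple of \<open>\<sigma>(x\<^sub>p)\<close> where \<open>p = p j\<close> is the row of the
  nonzero entry in column \<open>j\<close>; the map \<open>p\<close> is a permutation, so supports are merely relabelled.
\<close>
lemma semilinear_monomial_weight:
  assumes \<sigma>: "field_automorphism \<sigma>" and M: "monomial_mat n M" and x: "x \<in> carrier_vec n"
  shows "hamming_weight (semilinear_monomial n \<sigma> M x) = hamming_weight x"
proof -
  note D = field_automorphismD[OF \<sigma>]
  have Mc: "M \<in> carrier_mat n n" and rows: "\<And>i. i < n \<Longrightarrow> \<exists>!j. j < n \<and> M $$ (i, j) \<noteq> 0"
    and cols: "\<And>j. j < n \<Longrightarrow> \<exists>!i. i < n \<and> M $$ (i, j) \<noteq> 0"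
    using M unfolding monomial_mat_def by auto
  define p where "p j = (THE i. i < n \<and> M $$ (i, j) \<noteq> 0)" for j
  have p: "p j < n" "M $$ (p j, j) \<noteq> 0" if "j < n" for j
    using theI'[OF cols[OF that]] unfolding p_def by auto
  have puniq: "i = p j" if "i < n" "j < n" "M $$ (i, j) \<noteq> 0" for i j
    using cols[OF that(2)] p[OF that(2)] that by blast
  let ?y = "semilinear_monomial n \<sigma> M x"
  have y: "?y $ j = \<sigma> (M $$ (p j, j)) * \<sigma> (x $ p j)" if j: "j < n" for j
  proof -
    have "(transpose_mat M *\<^sub>v x) $ j = (\<Sum>i = 0..<n. M $$ (i, j) * x $ i)"
      using Mc x j by (auto simp: scalar_prod_def)
    also have "\<dots> = (\<Sum>i\<in>{p j}. M $$ (i, j) * x $ i)"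
    proof (intro sum.mono_neutral_right ballI)
      fix i assume "i \<in> {0..<n} - {p j}"
      then have "M $$ (i, j) = 0" using puniq[OF _ j, of i] by auto
      then show "M $$ (i, j) * x $ i = 0" by simp
    qed (use p[OF j] in auto)
    finally show ?thesis using x j Mc D by simp
  qed
  have dim: "dim_vec ?y = n" using x Mc by simp
  have "bij_betw p {j. j < dim_vec ?y \<and> ?y $ j \<noteq> 0} {i. i < dim_vec x \<and> x $ i \<noteq> 0}"
  proof (rule bij_betwI')
    fix i j assume "i \<in> {j. j < dim_vec ?y \<and> ?y $ j \<noteq> 0}" "j \<in> {j. j < dim_vec ?y \<and> ?y $ j \<noteq> 0}"
    then have "i < n" "j < n" using dim by auto
    then show "p i = p j \<longleftrightarrow> i = j" using rows[of "p i"] p by metis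
  next
    fix j assume "j \<in> {j. j < dim_vec ?y \<and> ?y $ j \<noteq> 0}"
    then have "j < n" "?y $ j \<noteq> 0" using dim by auto
    then show "p j \<in> {i. i < dim_vec x \<and> x $ i \<noteq> 0}" using y p x D(5) by auto
  next
    fix i assume "i \<in> {i. i < dim_vec x \<and> x $ i \<noteq> 0}"
    then have i: "i < n" "x $ i \<noteq> 0" using x by auto
    then obtain j where j: "j < n" "M $$ (i, j) \<noteq> 0" using rows by blast
    have "i = p j" using puniq i j by auto
    then show "\<exists>j\<in>{j. j < dim_vec ?y \<and> ?y $ j \<noteq> 0}. i = p j"
      using y[OF j(1)] dim i j D(5) by (intro bexI[of _ j]) auto
  qed
  then show ?thesis unfolding hamming_weight_def by (rule bij_betw_same_card)
qed

lemma semilinear_monomial_inj: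
  assumes \<sigma>: "field_automorphism \<sigma>" and M: "monomial_mat n M"
  shows "inj_on (semilinear_monomial n \<sigma> M) (carrier_vec n)"
proof (rule semilinear_map_inj_on)
  have Mc: "M \<in> carrier_mat n n" using M unfolding monomial_mat_def by auto
  show s: "semilinear_map \<sigma> n n (semilinear_monomial n \<sigma> M)"
    using semilinear_monomial_semilinear[OF \<sigma> Mc] .
  fix x :: "'a vec" assume x: "x \<in> carrier_vec n" and 0: "semilinear_monomial n \<sigma> M x = 0\<^sub>v n"
  have "hamming_weight x = 0" using semilinear_monomial_weight[OF \<sigma> M x] unfolding 0 by simp
  then show "x = 0\<^sub>v n" using hamming_weight_eq_0_iff[OF x] by simp
qed

lemma Aut_codeE:
  assumes "\<pi> \<in> carrier (Aut_code n C)"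
  obtains \<sigma> M where "field_automorphism \<sigma>" "monomial_mat n M" "\<pi> = semilinear_monomial n \<sigma> M" "\<pi> ` C = C"
    "semilinear_map \<sigma> n n \<pi>"
proof -
  obtain \<sigma> M where "field_automorphism \<sigma>" "monomial_mat n M" "\<pi> = semilinear_monomial n \<sigma> M" "\<pi> ` C = C"
    using assms unfolding Aut_code_def semilinear_monomial_maps_def by auto
  moreover from this have "semilinear_map \<sigma> n n \<pi>"
    using semilinear_monomial_semilinear[of \<sigma> M n] unfolding monomial_mat_def by blast
  ultimately show thesis using that by blast
qed

lemma Aut_codeI:
  assumes "field_automorphism \<sigma>" "monomial_mat n M" "semilinear_monomial n \<sigma> M ` C = C"
  shows "semilinear_monomial n \<sigma> M \<in> carrier (Aut_code n C)"
  using assms unfolding Aut_code_def semilinear_monomial_maps_def by auto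

lemma Aut_code_identity:
  fixes C :: "'a::field vec set"
  assumes C: "C \<subseteq> carrier_vec n"
  shows "\<exists>\<pi>\<in>carrier (Aut_code n C). \<forall>x\<in>carrier_vec n. \<pi> x = x"
proof -
  have \<sigma>: "field_automorphism (\<lambda>c::'a. c)"
    unfolding field_automorphism_def by (auto intro!: field_hom.intro bij_id[unfolded id_def]; unfold_locales; simp)
  have M: "monomial_mat n (1\<^sub>m n :: 'a mat)" unfolding monomial_mat_def by (auto split: if_splits)
  have id: "semilinear_monomial n (\<lambda>c::'a. c) (1\<^sub>m n) x = x" if "x \<in> carrier_vec n" for x :: "'a vec"
    using that by (auto simp: vec_eq_iff)
  then have "semilinear_monomial n (\<lambda>c::'a. c) (1\<^sub>m n) ` C = C" using C by force
  then show ?thesis using Aut_codeI[OF \<sigma> M] id by blast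
qed

lemma Aut_code_image_coset:
  fixes C :: "'a::field vec set"
  assumes C: "linear_code n C" and \<pi>: "\<pi> \<in> carrier (Aut_code n C)" and v: "v \<in> carrier_vec n"
  shows "\<pi> ` coset C v = coset C (\<pi> v)"
proof -
  obtain \<sigma> where A: "\<pi> ` C = C" "semilinear_map \<sigma> n n \<pi>" using Aut_codeE[OF \<pi>] by metis
  have "\<pi> ` coset C v = (\<lambda>h. \<pi> h + \<pi> v) ` C"
    using semilinear_mapD(3)[OF A(2) _ v] linear_codeD(1)[OF C]
    unfolding image_image by (intro image_cong) auto
  also have "\<dots> = coset (\<pi> ` C) (\<pi> v)" by (simp only: image_image)
  also have "\<dots> = coset C (\<pi> v)" by (simp only: A(1))
  finally show ?thesis .
qed

lemma Aut_code_coset_weight: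
  assumes \<pi>: "\<pi> \<in> carrier (Aut_code n C)" and K: "K \<subseteq> carrier_vec n"
  shows "coset_weight (\<pi> ` K) = coset_weight K"
proof -
  obtain \<sigma> M where A: "field_automorphism \<sigma>" "monomial_mat n M" "\<pi> = semilinear_monomial n \<sigma> M"
    using Aut_codeE[OF \<pi>] by metis
  have "hamming_weight ` \<pi> ` K = hamming_weight ` K"
    unfolding image_image using K semilinear_monomial_weight[OF A(1,2)] A(3) by (intro image_cong) auto
  then show ?thesis unfolding coset_weight_def by simp
qed

section \<open>Complete transitivity in terms of coset weights\<close>

text \<open>
  Automorphisms preserve coset weights, so every orbit lies in one weight class, and by
  \<open>coset_weights\<close> there are \<open>\<rho> + 1\<close> nonempty weight classes.  Having exactly \<open>\<rho> + 1\<close> orbits thus means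
  that each weight class is a single orbit.
\<close>
lemma completely_transitive_iff:
  fixes C :: "'a::{field,finite} vec set"
  shows "completely_transitive n C \<longleftrightarrow> linear_code n C \<and>
    (\<forall>K\<in>code_cosets n C. \<forall>L\<in>code_cosets n C.
       coset_weight K = coset_weight L \<longrightarrow> (\<exists>\<pi>\<in>carrier (Aut_code n C). \<pi> ` K = L))"
proof (cases "linear_code n C")
  case C: True
  let ?Q = "code_cosets n C" and ?r = "covering_radius n C"
  let ?orb = "\<lambda>K. orbit (Aut_code n C) (\<lambda>\<pi> K. \<pi> ` K) K"
  let ?O = "orbits (Aut_code n C) ?Q (\<lambda>\<pi> K. \<pi> ` K)"
  define W where "W k = {K \<in> ?Q. coset_weight K = k}" for k
  \<comment> \<open>All cosets in an orbit have the same weight, so the choice does not matter.\<close>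
  define wt where "wt X = coset_weight (SOME K. K \<in> X)" for X :: "'a vec set set"
  have O: "?O = ?orb ` ?Q" unfolding orbits_def by blast
  have Qsub: "K \<subseteq> carrier_vec n" if "K \<in> ?Q" for K
    using that coset_subset(1)[OF C] unfolding code_cosets_eq by blast
  have mem: "K \<in> ?orb K" if K: "K \<in> ?Q" for K
  proof -
    obtain \<pi> where \<pi>: "\<pi> \<in> carrier (Aut_code n C)" "\<forall>x\<in>carrier_vec n. \<pi> x = x"
      using Aut_code_identity[OF linear_codeD(1)[OF C]] by auto
    then have "\<pi> ` K = K" using Qsub[OF K] by force
    then show ?thesis unfolding orbit_def using \<pi>(1) by blast
  qed
  have sub: "?orb K \<subseteq> W (coset_weight K)" if K: "K \<in> ?Q" for K
  proof
    fix L assume "L \<in> ?orb K"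
    then obtain \<pi> where \<pi>: "\<pi> \<in> carrier (Aut_code n C)" "L = \<pi> ` K" unfolding orbit_def by auto
    obtain v where v: "v \<in> carrier_vec n" "K = coset C v" using K unfolding code_cosets_eq by auto
    obtain \<sigma> where "semilinear_map \<sigma> n n \<pi>" using Aut_codeE[OF \<pi>(1)] by metis
    then have "\<pi> v \<in> carrier_vec n" using semilinear_mapD(2) v by metis
    then have "L \<in> ?Q" using Aut_code_image_coset[OF C \<pi>(1) v(1)] \<pi>(2) v unfolding code_cosets_eq by auto
    then show "L \<in> W (coset_weight K)"
      unfolding W_def using Aut_code_coset_weight[OF \<pi>(1) Qsub[OF K]] \<pi>(2) by simp
  qed
  have wt: "wt (?orb K) = coset_weight K" if K: "K \<in> ?Q" for K
    using someI[of "\<lambda>L. L \<in> ?orb K", OF mem[OF K]] sub[OF K] unfolding wt_def W_def by blast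
  have wtO: "wt ` ?O = {..?r}"
    unfolding O coset_weights[OF C, symmetric] image_image using wt by (intro image_cong) auto
  show ?thesis
  proof (intro iffI conjI C ballI impI)
    fix K L assume ct: "completely_transitive n C" and K: "K \<in> ?Q" and L: "L \<in> ?Q"
      and eq: "coset_weight K = coset_weight L"
    have card: "card ?O = card (wt ` ?O)" using ct unfolding completely_transitive_def wtO by simp
    have "finite ?Q" unfolding code_cosets_eq by (simp add: finite_carrier_vec)
    then have "inj_on wt ?O" using card unfolding O by (intro eq_card_imp_inj_on) auto
    moreover have "wt (?orb K) = wt (?orb L)" using wt[OF K] wt[OF L] eq by simp
    ultimately have "?orb K = ?orb L" by (rule inj_onD) (use K L in \<open>auto simp only: O\<close>)
    then have "L \<in> ?orb K" using mem[OF L] by simp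
    then show "\<exists>\<pi>\<in>carrier (Aut_code n C). \<pi> ` K = L" unfolding orbit_def by auto
  next
    assume trans: "linear_code n C \<and> (\<forall>K\<in>?Q. \<forall>L\<in>?Q. coset_weight K = coset_weight L \<longrightarrow>
       (\<exists>\<pi>\<in>carrier (Aut_code n C). \<pi> ` K = L))"
    have orb: "?orb K = W (coset_weight K)" if K: "K \<in> ?Q" for K
    proof
      show "W (coset_weight K) \<subseteq> ?orb K"
      proof
        fix L assume "L \<in> W (coset_weight K)"
        then have "L \<in> ?Q" "coset_weight K = coset_weight L" unfolding W_def by simp_all
        then obtain \<pi> where "\<pi> \<in> carrier (Aut_code n C)" "\<pi> ` K = L" using trans K by metis
        then show "L \<in> ?orb K" unfolding orbit_def by auto
      qed
    qed (rule sub[OF K])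
    have "inj_on wt ?O"
    proof (rule inj_onI)
      fix X Y assume "X \<in> ?O" "Y \<in> ?O" and eq: "wt X = wt Y"
      then obtain K L where KL: "K \<in> ?Q" "X = ?orb K" "L \<in> ?Q" "Y = ?orb L" unfolding O by auto
      then have "coset_weight K = coset_weight L" using wt[of K] wt[of L] eq by simp
      then show "X = Y" using orb[of K] orb[of L] KL by simp
    qed
    then have "card ?O = card {..?r}" using card_image[of wt ?O] wtO by simp
    then show "completely_transitive n C" unfolding completely_transitive_def using C by simp
  qed
qed (simp add: completely_transitive_def)

section \<open>Syndromes\<close>

definition syndrome_class :: "'a::semiring_0 mat \<Rightarrow> 'a vec \<Rightarrow> 'a vec set" where
  "syndrome_class H s = {x \<in> carrier_vec (dim_col H). H *\<^sub>v x = s}"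

text \<open>
  The zero scalar is excluded, so for a matrix without zero columns these are the vectors on the
  points of projective space that the columns represent.
\<close>
definition column_multiples :: "'a::semiring_0 mat \<Rightarrow> 'a vec set" where
  "column_multiples H = {c \<cdot>\<^sub>v col H i | c i. c \<noteq> 0 \<and> i < dim_col H}"

lemma coset_kernel_eq_syndrome_class:
  fixes H :: "'a::field mat"
  assumes H: "H \<in> carrier_mat m n" and v: "v \<in> carrier_vec n"
  shows "coset (mat_kernel H) v = syndrome_class H (H *\<^sub>v v)"
proof (intro equalityI subsetI)
  fix x assume "x \<in> coset (mat_kernel H) v"
  then show "x \<in> syndrome_class H (H *\<^sub>v v)"
    using H v mat_kernelD[OF H] unfolding syndrome_class_def
    by (auto simp: mult_add_distrib_mat_vec[OF H])
next
  fix x assume "x \<in> syndrome_class H (H *\<^sub>v v)"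
  then have x: "x \<in> carrier_vec n" "H *\<^sub>v x = H *\<^sub>v v" using H unfolding syndrome_class_def by auto
  have "x - v \<in> mat_kernel H"
    using H x v by (intro mat_kernelI[OF H]) (auto simp: mult_minus_distrib_mat_vec[OF H])
  moreover have "x = (x - v) + v" using x v by auto
  ultimately show "x \<in> coset (mat_kernel H) v" by blast
qed

lemma code_cosets_kernel:
  fixes H :: "'a::field mat"
  assumes H: "H \<in> carrier_mat m n"
  shows "code_cosets n (mat_kernel H) = syndrome_class H ` (*\<^sub>v) H ` carrier_vec n"
  unfolding code_cosets_eq image_image using coset_kernel_eq_syndrome_class[OF H]
  by (intro image_cong) auto

lemma syndrome_class_weight_eq_0_iff:
  fixes H :: "'a::{field,finite} mat"
  assumes H: "H \<in> carrier_mat m n" and s: "s \<in> (*\<^sub>v) H ` carrier_vec n"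
  shows "coset_weight (syndrome_class H s) = 0 \<longleftrightarrow> s = 0\<^sub>v m"
proof -
  have sub: "syndrome_class H s \<subseteq> carrier_vec n" and ne: "syndrome_class H s \<noteq> {}"
    using H s unfolding syndrome_class_def by auto
  have H0: "H *\<^sub>v 0\<^sub>v n = 0\<^sub>v m" using H by (auto simp: vec_eq_iff)
  show ?thesis
  proof
    assume 0: "coset_weight (syndrome_class H s) = 0"
    obtain x where x: "x \<in> syndrome_class H s" "hamming_weight x = 0"
      using coset_weight_leader[OF sub ne] 0 by metis
    then have "x = 0\<^sub>v n" using hamming_weight_eq_0_iff[of x n] sub by auto
    then show "s = 0\<^sub>v m" using x H0 unfolding syndrome_class_def by auto
  next
    assume "s = 0\<^sub>v m"
    then have "0\<^sub>v n \<in> syndrome_class H s" using H0 H unfolding syndrome_class_def by auto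
    then show "coset_weight (syndrome_class H s) = 0"
      using coset_weight_le[OF sub, of "0\<^sub>v n"] by simp
  qed
qed

lemma mult_mat_vec_unit:
  fixes H :: "'a::field mat"
  assumes H: "H \<in> carrier_mat m n" and i: "i < n"
  shows "H *\<^sub>v (c \<cdot>\<^sub>v unit_vec n i) = c \<cdot>\<^sub>v col H i"
proof -
  have "H *\<^sub>v (c \<cdot>\<^sub>v unit_vec n i) = c \<cdot>\<^sub>v (H *\<^sub>v unit_vec n i)" by (rule mult_mat_vec[OF H]) simp
  also have "H *\<^sub>v unit_vec n i = col H i"
    using H i by (intro eq_vecI) auto
  finally show ?thesis .
qed

lemma syndrome_class_weight_eq_1_iff:
  fixes H :: "'a::{field,finite} mat"
  assumes H: "H \<in> carrier_mat m n" and s: "s \<in> (*\<^sub>v) H ` carrier_vec n"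
    and nz: "0\<^sub>v m \<notin> column_multiples H"
  shows "coset_weight (syndrome_class H s) = 1 \<longleftrightarrow> s \<in> column_multiples H"
proof -
  have sub: "syndrome_class H s \<subseteq> carrier_vec n" and ne: "syndrome_class H s \<noteq> {}"
    using H s unfolding syndrome_class_def by auto
  show ?thesis
  proof
    assume 1: "coset_weight (syndrome_class H s) = 1"
    obtain x where x: "x \<in> syndrome_class H s" "hamming_weight x = Suc 0"
      using coset_weight_leader[OF sub ne] 1 by (metis One_nat_def)
    then have xc: "x \<in> carrier_vec n" using sub by auto
    obtain y c i where y: "i < n" "c \<noteq> 0" "y \<in> carrier_vec n" "hamming_weight y = 0"
      "x = y + c \<cdot>\<^sub>v unit_vec n i"
      using hamming_weight_SucE[OF xc x(2)] by metis
    then have "x = c \<cdot>\<^sub>v unit_vec n i" using hamming_weight_eq_0_iff[OF y(3)] by simp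
    then have "s = c \<cdot>\<^sub>v col H i" using x(1) mult_mat_vec_unit[OF H y(1)] unfolding syndrome_class_def by auto
    then show "s \<in> column_multiples H" using y H unfolding column_multiples_def by auto
  next
    assume sp: "s \<in> column_multiples H"
    then obtain c i where c: "c \<noteq> 0" "i < n" "s = c \<cdot>\<^sub>v col H i" using H unfolding column_multiples_def by auto
    let ?x = "0\<^sub>v n + c \<cdot>\<^sub>v unit_vec n i"
    have "?x \<in> syndrome_class H s"
      using H c mult_mat_vec_unit[OF H c(2)] unfolding syndrome_class_def by simp
    then have "coset_weight (syndrome_class H s) \<le> hamming_weight ?x" by (rule coset_weight_le[OF sub])
    also have "\<dots> \<le> Suc (hamming_weight (0\<^sub>v n :: 'a vec))" by (rule hamming_weight_add_unit_le) simp
    also have "\<dots> = 1" by simp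
    finally have "coset_weight (syndrome_class H s) \<le> 1" .
    moreover have "coset_weight (syndrome_class H s) \<noteq> 0"
      using syndrome_class_weight_eq_0_iff[OF H s] sp nz by auto
    ultimately show "coset_weight (syndrome_class H s) = 1" by simp
  qed
qed

lemma Aut_code_image_syndrome_class:
  fixes H :: "'a::field mat"
  assumes H: "H \<in> carrier_mat m n" and \<pi>: "\<pi> \<in> carrier (Aut_code n (mat_kernel H))"
    and x: "x \<in> carrier_vec n"
  shows "\<pi> ` syndrome_class H (H *\<^sub>v x) = syndrome_class H (H *\<^sub>v \<pi> x)"
proof -
  obtain \<sigma> where \<pi>s: "semilinear_map \<sigma> n n \<pi>" using Aut_codeE[OF \<pi>] by metis
  show ?thesis
    using Aut_code_image_coset[OF linear_code_kernel[OF H] \<pi> x]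
    by (simp only: coset_kernel_eq_syndrome_class[OF H] x semilinear_mapD(2)[OF \<pi>s x])
qed

text \<open>
  An automorphism permutes the cosets, and by surjectivity cosets correspond to all vectors of
  \<open>F\<^sup>m\<close>.  The resulting map inherits semilinearity, because \<open>\<phi>(H x) = H \<pi>(x)\<close>.
\<close>
lemma Aut_code_induces_syndrome_map:
  fixes H :: "'a::{field,finite} mat"
  assumes H: "H \<in> carrier_mat m n" and surj: "(*\<^sub>v) H ` carrier_vec n = carrier_vec m"
    and \<pi>: "\<pi> \<in> carrier (Aut_code n (mat_kernel H))"
  obtains \<sigma> \<phi> where "semilinear_map \<sigma> m m \<phi>"
    "\<And>s. s \<in> carrier_vec m \<Longrightarrow> \<pi> ` syndrome_class H s = syndrome_class H (\<phi> s)"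
    "\<And>s. s \<in> carrier_vec m \<Longrightarrow> coset_weight (syndrome_class H (\<phi> s)) = coset_weight (syndrome_class H s)"
proof -
  obtain \<sigma> where \<pi>s: "semilinear_map \<sigma> n n \<pi>" using Aut_codeE[OF \<pi>] by metis
  note P = semilinear_mapD[OF \<pi>s]
  define \<phi> where "\<phi> s = H *\<^sub>v \<pi> (SOME x. x \<in> carrier_vec n \<and> H *\<^sub>v x = s)" for s
  have \<phi>: "\<phi> (H *\<^sub>v x) = H *\<^sub>v \<pi> x" if x: "x \<in> carrier_vec n" for x
  proof -
    define y where "y = (SOME y. y \<in> carrier_vec n \<and> H *\<^sub>v y = H *\<^sub>v x)"
    have "y \<in> carrier_vec n \<and> H *\<^sub>v y = H *\<^sub>v x"
      unfolding y_def by (rule someI[of _ x]) (simp add: x)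
    then have y: "y \<in> carrier_vec n" "y \<in> syndrome_class H (H *\<^sub>v x)"
      using H unfolding syndrome_class_def by auto
    then have "\<pi> y \<in> syndrome_class H (H *\<^sub>v \<pi> x)"
      using Aut_code_image_syndrome_class[OF H \<pi> x] by blast
    then show ?thesis unfolding \<phi>_def y_def[symmetric] syndrome_class_def by simp
  qed
  have pre: "\<exists>x\<in>carrier_vec n. s = H *\<^sub>v x" if "s \<in> carrier_vec m" for s
    using that surj by blast
  have "semilinear_map \<sigma> m m \<phi>"
    unfolding semilinear_map_def
  proof (intro conjI ballI allI P(1))
    fix s :: "'a vec" assume "s \<in> carrier_vec m"
    then obtain x where x: "x \<in> carrier_vec n" "s = H *\<^sub>v x" using pre by blast
    show "\<phi> s \<in> carrier_vec m" unfolding x(2) \<phi>[OF x(1)] using H P(2)[OF x(1)] by simp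
    fix c
    have "\<phi> (c \<cdot>\<^sub>v (H *\<^sub>v x)) = \<phi> (H *\<^sub>v (c \<cdot>\<^sub>v x))" using mult_mat_vec[OF H x(1)] by simp
    also have "\<dots> = H *\<^sub>v (\<sigma> c \<cdot>\<^sub>v \<pi> x)" using \<phi>[of "c \<cdot>\<^sub>v x"] x(1) P(4)[OF x(1)] by simp
    also have "\<dots> = \<sigma> c \<cdot>\<^sub>v \<phi> (H *\<^sub>v x)" using mult_mat_vec[OF H P(2)[OF x(1)]] \<phi>[OF x(1)] by simp
    finally show "\<phi> (c \<cdot>\<^sub>v s) = \<sigma> c \<cdot>\<^sub>v \<phi> s" unfolding x(2) .
  next
    fix s t :: "'a vec" assume "s \<in> carrier_vec m" "t \<in> carrier_vec m"
    then obtain x y where x: "x \<in> carrier_vec n" "s = H *\<^sub>v x" and y: "y \<in> carrier_vec n" "t = H *\<^sub>v y"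
      using pre by blast
    have "\<phi> (H *\<^sub>v x + H *\<^sub>v y) = \<phi> (H *\<^sub>v (x + y))" using mult_add_distrib_mat_vec[OF H x(1) y(1)] by simp
    also have "\<dots> = H *\<^sub>v (\<pi> x + \<pi> y)" using \<phi>[of "x + y"] P(3)[OF x(1) y(1)] x y by simp
    also have "\<dots> = \<phi> (H *\<^sub>v x) + \<phi> (H *\<^sub>v y)"
      using mult_add_distrib_mat_vec[OF H P(2)[OF x(1)] P(2)[OF y(1)]] \<phi>[OF x(1)] \<phi>[OF y(1)] by simp
    finally show "\<phi> (s + t) = \<phi> s + \<phi> t" unfolding x(2) y(2) .
  qed
  moreover have img: "\<pi> ` syndrome_class H s = syndrome_class H (\<phi> s)" if s: "s \<in> carrier_vec m" for s
  proof -
    obtain x where x: "x \<in> carrier_vec n" "s = H *\<^sub>v x" using pre[OF s] by blast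
    show ?thesis unfolding x(2) \<phi>[OF x(1)] by (rule Aut_code_image_syndrome_class[OF H \<pi> x(1)])
  qed
  moreover have "coset_weight (syndrome_class H (\<phi> s)) = coset_weight (syndrome_class H s)"
    if s: "s \<in> carrier_vec m" for s
    unfolding img[OF s, symmetric] using H
    by (intro Aut_code_coset_weight[OF \<pi>]) (auto simp: syndrome_class_def)
  ultimately show thesis using that by blast
qed

lemma semilinear_map_mult_mat_vec:
  assumes f: "semilinear_map \<sigma> n k f" and H: "H \<in> carrier_mat m k"
  shows "semilinear_map \<sigma> n m (\<lambda>x. H *\<^sub>v f x)"
proof -
  note F = semilinear_mapD[OF f]
  show ?thesis
    unfolding semilinear_map_def
  proof (intro conjI ballI allI F(1))
    fix x :: "'a vec" assume x: "x \<in> carrier_vec n"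
    show "H *\<^sub>v f x \<in> carrier_vec m" using H F(2)[OF x] by simp
    show "H *\<^sub>v f (c \<cdot>\<^sub>v x) = \<sigma> c \<cdot>\<^sub>v (H *\<^sub>v f x)" for c
      using F(4)[OF x] mult_mat_vec[OF H F(2)[OF x]] by simp
    fix y :: "'a vec" assume y: "y \<in> carrier_vec n"
    show "H *\<^sub>v f (x + y) = H *\<^sub>v f x + H *\<^sub>v f y"
      using F(3)[OF x y] mult_add_distrib_mat_vec[OF H F(2)[OF x] F(2)[OF y]] by simp
  qed
qed

lemma semilinear_map_comp_mult_mat_vec:
  assumes f: "semilinear_map \<sigma> m k f" and H: "H \<in> carrier_mat m n"
  shows "semilinear_map \<sigma> n k (\<lambda>x. f (H *\<^sub>v x))"
proof -
  note F = semilinear_mapD[OF f]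
  have Hx: "H *\<^sub>v x \<in> carrier_vec m" for x using H by (intro carrier_vecI) auto
  show ?thesis
    unfolding semilinear_map_def
  proof (intro conjI ballI allI F(1))
    fix x :: "'a vec" assume x: "x \<in> carrier_vec n"
    show "f (H *\<^sub>v x) \<in> carrier_vec k" using F(2)[OF Hx] .
    show "f (H *\<^sub>v (c \<cdot>\<^sub>v x)) = \<sigma> c \<cdot>\<^sub>v f (H *\<^sub>v x)" for c
      using F(4)[OF Hx] mult_mat_vec[OF H x] by simp
    fix y :: "'a vec" assume y: "y \<in> carrier_vec n"
    show "f (H *\<^sub>v (x + y)) = f (H *\<^sub>v x) + f (H *\<^sub>v y)"
      using F(3)[OF Hx Hx] mult_add_distrib_mat_vec[OF H x y] by simp
  qed
qed

text \<open>
  Being injective on a finite set, \<open>\<phi>\<close> permutes the multiples of columns, so each column \<open>h\<^sub>j\<close> is, up to a scalar, the image of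
  some column \<open>h\<^sub>i\<close> with \<open>i = q j\<close>.  Pairwise independence makes \<open>q\<close> a permutation, and the monomial
  map that sends the unit vector \<open>e\<^sub>i\<close> to the corresponding multiple of \<open>e\<^sub>j\<close> agrees with \<open>\<phi>\<close> on
  syndromes because it does so for unit vectors.
\<close>
lemma syndrome_map_lifts_to_Aut_code:
  fixes H :: "'a::{field,finite} mat"
  assumes H: "H \<in> carrier_mat m n"
    and indpt: "\<And>i j c. i < n \<Longrightarrow> j < n \<Longrightarrow> col H i = c \<cdot>\<^sub>v col H j \<Longrightarrow> i = j"
    and \<phi>: "semilinear_map \<sigma> m m \<phi>" and inj: "inj_on \<phi> (carrier_vec m)"
    and pres: "\<phi> ` column_multiples H \<subseteq> column_multiples H"
  obtains \<pi> where "\<pi> \<in> carrier (Aut_code n (mat_kernel H))"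
    "\<And>x. x \<in> carrier_vec n \<Longrightarrow> H *\<^sub>v \<pi> x = \<phi> (H *\<^sub>v x)"
proof -
  note F = semilinear_mapD[OF \<phi>] and S = field_automorphismD[OF semilinear_mapD(1)[OF \<phi>]]
  have colc: "col H i \<in> carrier_vec m" for i using H by auto
  have Psub: "column_multiples H \<subseteq> carrier_vec m" unfolding column_multiples_def using colc by auto
  then have "finite (column_multiples H)" using finite_subset finite_carrier_vec by metis
  then have onto: "\<phi> ` column_multiples H = column_multiples H"
    using endo_inj_surj[OF _ pres inj_on_subset[OF inj Psub]] by simp
  have "\<exists>i c. i < n \<and> c \<noteq> 0 \<and> \<phi> (col H i) = c \<cdot>\<^sub>v col H j" if j: "j < n" for j
  proof -
    have "col H j \<in> column_multiples H"
      unfolding column_multiples_def using j H by (intro CollectI exI[of _ 1] exI[of _ j]) simp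
    then obtain d i where d: "d \<noteq> 0" "i < n" "col H j = \<phi> (d \<cdot>\<^sub>v col H i)"
      using onto H unfolding column_multiples_def by blast
    then have "col H j = \<sigma> d \<cdot>\<^sub>v \<phi> (col H i)" using F(4)[OF colc] by simp
    then have "\<phi> (col H i) = inverse (\<sigma> d) \<cdot>\<^sub>v col H j"
      using d S(5)[of d] by (simp add: smult_smult_assoc)
    then show ?thesis using d S(5)[of d] by (metis nonzero_imp_inverse_nonzero)
  qed
  then obtain q c where q: "\<And>j. j < n \<Longrightarrow> q j < n" and c: "\<And>j. j < n \<Longrightarrow> c j \<noteq> 0"
    and qc: "\<And>j. j < n \<Longrightarrow> \<phi> (col H (q j)) = c j \<cdot>\<^sub>v col H j"
    by metis
  have qinj: "j = j'" if j: "j < n" "j' < n" and eq: "q j = q j'" for j j'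
  proof -
    have "c j \<cdot>\<^sub>v col H j = c j' \<cdot>\<^sub>v col H j'" using qc[OF j(1)] qc[OF j(2)] eq by simp
    then have "inverse (c j) \<cdot>\<^sub>v (c j \<cdot>\<^sub>v col H j) = inverse (c j) \<cdot>\<^sub>v (c j' \<cdot>\<^sub>v col H j')" by simp
    then have "col H j = (inverse (c j) * c j') \<cdot>\<^sub>v col H j'" using c[OF j(1)] by (simp add: smult_smult_assoc)
    then show ?thesis using indpt j by blast
  qed
  have qsurj: "\<exists>j<n. i = q j" if i: "i < n" for i
  proof -
    have "q ` {..<n} = {..<n}"
      using q qinj by (intro endo_inj_surj) (auto intro: inj_onI)
    then show ?thesis using i by auto
  qed
  \<comment> \<open>The map applies \<open>\<sigma>\<close> last, hence the entry is the \<open>\<sigma>\<close>-preimage of the scalar.\<close>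
  define M where "M = mat n n (\<lambda>(i, j). if i = q j then inv_into UNIV \<sigma> (c j) else 0)"
  have Mij: "M $$ (i, j) = (if i = q j then inv_into UNIV \<sigma> (c j) else 0)" if "i < n" "j < n" for i j
    using that unfolding M_def by simp
  have \<sigma>inv: "\<sigma> (inv_into UNIV \<sigma> d) = d" for d using S(6) by (simp add: bij_is_surj surj_f_inv_f)
  have cnz: "inv_into UNIV \<sigma> (c j) \<noteq> 0" if "j < n" for j using \<sigma>inv[of "c j"] c[OF that] S(3) by auto
  have Mc: "M \<in> carrier_mat n n" unfolding M_def by simp
  have M: "monomial_mat n M"
    unfolding monomial_mat_def
  proof (intro conjI Mc allI impI)
    fix i assume i: "i < n"
    then obtain j where j: "j < n" "i = q j" using qsurj by blast
    show "\<exists>!j. j < n \<and> M $$ (i, j) \<noteq> 0"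
    proof (rule ex1I[of _ j])
      show "j < n \<and> M $$ (i, j) \<noteq> 0" using Mij[OF i j(1)] j cnz by simp
      fix k assume k: "k < n \<and> M $$ (i, k) \<noteq> 0"
      then have "i = q k" using Mij[OF i, of k] by (auto split: if_splits)
      then have "q k = q j" by (simp only: j(2))
      then show "k = j" using qinj[OF _ j(1)] k by blast
    qed
  next
    fix j assume j: "j < n"
    show "\<exists>!i. i < n \<and> M $$ (i, j) \<noteq> 0"
    proof (rule ex1I[of _ "q j"])
      show "q j < n \<and> M $$ (q j, j) \<noteq> 0" using Mij[OF q[OF j] j] q[OF j] cnz[OF j] by simp
      fix i assume i: "i < n \<and> M $$ (i, j) \<noteq> 0"
      then show "i = q j" using Mij[OF _ j, of i] by (auto split: if_splits)
    qed
  qed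
  define \<pi> where "\<pi> = semilinear_monomial n \<sigma> M"
  have \<pi>: "semilinear_map \<sigma> n n \<pi>" unfolding \<pi>_def by (rule semilinear_monomial_semilinear[OF F(1) Mc])
  have unit: "\<pi> (unit_vec n (q j)) = c j \<cdot>\<^sub>v unit_vec n j" if j: "j < n" for j
  proof (rule eq_vecI)
    fix k assume "k < dim_vec (c j \<cdot>\<^sub>v unit_vec n j)"
    then have k: "k < n" by simp
    have "\<pi> (unit_vec n (q j)) $ k = \<sigma> (M $$ (q j, k))"
      unfolding \<pi>_def using Mc k q[OF j] by simp
    also have "\<dots> = (if k = j then c j else 0)"
      using Mij[OF q[OF j] k] qinj[OF j k] \<sigma>inv S(3) by auto
    finally show "\<pi> (unit_vec n (q j)) $ k = (c j \<cdot>\<^sub>v unit_vec n j) $ k" using j k by simp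
  qed (use semilinear_mapD(2)[OF \<pi>, of "unit_vec n (q j)"] in simp)
  have lift: "H *\<^sub>v \<pi> x = \<phi> (H *\<^sub>v x)" if x: "x \<in> carrier_vec n" for x
  proof (rule semilinear_map_eqI[OF semilinear_map_mult_mat_vec[OF \<pi> H]
        semilinear_map_comp_mult_mat_vec[OF \<phi> H] _ x])
    fix i assume "i < n"
    then obtain j where j: "j < n" "i = q j" using qsurj by blast
    have Hu: "H *\<^sub>v unit_vec n i = col H i" using mult_mat_vec_unit[OF H \<open>i < n\<close>, of 1] by simp
    show "H *\<^sub>v \<pi> (unit_vec n i) = \<phi> (H *\<^sub>v unit_vec n i)"
      unfolding Hu unfolding j(2) unit[OF j(1)] qc[OF j(1)] by (rule mult_mat_vec_unit[OF H j(1)])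
  qed
  have "\<pi> ` mat_kernel H = mat_kernel H"
  proof (rule endo_inj_surj)
    note Ks = mat_kernel_carrier[OF H]
    show "finite (mat_kernel H)" using finite_subset[OF Ks finite_carrier_vec] .
    show "inj_on \<pi> (mat_kernel H)"
      unfolding \<pi>_def by (rule inj_on_subset[OF semilinear_monomial_inj[OF F(1) M] Ks])
    show "\<pi> ` mat_kernel H \<subseteq> mat_kernel H"
    proof
      fix y assume "y \<in> \<pi> ` mat_kernel H"
      then obtain x where x: "x \<in> mat_kernel H" "y = \<pi> x" by auto
      note X = mat_kernelD[OF H x(1)]
      show "y \<in> mat_kernel H"
        using lift[OF X(1)] X(2) semilinear_map_zero[OF \<phi>] semilinear_mapD(2)[OF \<pi> X(1)] x(2)
        by (intro mat_kernelI[OF H]) simp_all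
    qed
  qed
  then have "\<pi> \<in> carrier (Aut_code n (mat_kernel H))"
    unfolding \<pi>_def by (rule Aut_codeI[OF F(1) M])
  then show thesis using that lift by blast
qed

section \<open>Transfer between complementary sets of columns\<close>

text \<open>
  The heart of the argument: the two families of column multiples are told apart by coset weights of
  \<open>ker H_A\<close> alone, so the syndrome maps of its automorphisms respect both families.
\<close>
lemma completely_transitive_complementary_columns:
  fixes H_A H_B :: "'a::{field,finite} mat"
  assumes A: "H_A \<in> carrier_mat m a" and B: "H_B \<in> carrier_mat m b"
    and cover: "column_multiples H_A \<union> column_multiples H_B = carrier_vec m - {0\<^sub>v m}"
    and disj: "column_multiples H_A \<inter> column_multiples H_B = {}"
    and indpt: "\<And>i j c. i < b \<Longrightarrow> j < b \<Longrightarrow> col H_B i = c \<cdot>\<^sub>v col H_B j \<Longrightarrow> i = j"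
    and surj: "(*\<^sub>v) H_A ` carrier_vec a = carrier_vec m"
    and ct: "completely_transitive a (mat_kernel H_A)"
    and radius: "covering_radius a (mat_kernel H_A) = 2"
  shows "completely_transitive b (mat_kernel H_B)"
  unfolding completely_transitive_iff
proof (intro conjI ballI impI linear_code_kernel[OF B])
  fix K L assume "K \<in> code_cosets b (mat_kernel H_B)" "L \<in> code_cosets b (mat_kernel H_B)"
    and eq: "coset_weight K = coset_weight L"
  then obtain x y where x: "x \<in> carrier_vec b" "K = syndrome_class H_B (H_B *\<^sub>v x)"
    and y: "y \<in> carrier_vec b" "L = syndrome_class H_B (H_B *\<^sub>v y)"
    unfolding code_cosets_kernel[OF B] by auto
  define s t where "s = H_B *\<^sub>v x" and "t = H_B *\<^sub>v y"
  have sB: "s \<in> (*\<^sub>v) H_B ` carrier_vec b" and tB: "t \<in> (*\<^sub>v) H_B ` carrier_vec b"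
    using x y unfolding s_def t_def by auto
  have sc: "s \<in> carrier_vec m" and tc: "t \<in> carrier_vec m" 
    using mult_mat_vec_carrier[OF B] x(1) y(1) unfolding s_def t_def by blast+
  let ?wA = "\<lambda>s. coset_weight (syndrome_class H_A s)" and ?wB = "\<lambda>s. coset_weight (syndrome_class H_B s)"
  have nzA: "0\<^sub>v m \<notin> column_multiples H_A" and nzB: "0\<^sub>v m \<notin> column_multiples H_B" using cover by auto
  have A0: "?wA s = 0 \<longleftrightarrow> s = 0\<^sub>v m" if "s \<in> carrier_vec m" for s
    by (rule syndrome_class_weight_eq_0_iff[OF A]) (simp only: surj that)
  have A1: "?wA s = 1 \<longleftrightarrow> s \<in> column_multiples H_A" if "s \<in> carrier_vec m" for s
    by (rule syndrome_class_weight_eq_1_iff[OF A _ nzA]) (simp only: surj that)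
  have A2: "?wA s \<le> 2" if s: "s \<in> carrier_vec m" for s
  proof -
    have "syndrome_class H_A s \<in> code_cosets a (mat_kernel H_A)"
      unfolding code_cosets_kernel[OF A] surj using s by (rule imageI)
    then show ?thesis using coset_weight_le_covering_radius[OF linear_code_kernel[OF A]] radius by metis
  qed
  \<comment> \<open>As the covering radius is 2, what is neither zero nor a multiple of a column of \<open>H_A\<close> has weight 2.\<close>
  have mult_B: "s \<in> column_multiples H_B \<longleftrightarrow> ?wA s = 2" if s: "s \<in> carrier_vec m" for s
  proof -
    have "s \<in> column_multiples H_B \<longleftrightarrow> s \<noteq> 0\<^sub>v m \<and> s \<notin> column_multiples H_A"
      using cover disj s nzB by blast
    also have "\<dots> \<longleftrightarrow> ?wA s \<noteq> 0 \<and> ?wA s \<noteq> 1" using A0[OF s] A1[OF s] by simp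
    also have "\<dots> \<longleftrightarrow> ?wA s = 2" using A2[OF s] by arith
    finally show ?thesis .
  qed
  \<comment> \<open>\<open>{0}\<close> and the multiples of columns of \<open>H_B\<close> are the weight classes 0 and 1 for \<open>H_B\<close>; all
    other syndromes are multiples of columns of \<open>H_A\<close>, hence in a single class for \<open>H_A\<close>.\<close>
  have wA: "?wA s = ?wA t"
  proof -
    have w: "?wB s = ?wB t" using eq x y unfolding s_def t_def by simp
    have "s = 0\<^sub>v m \<longleftrightarrow> t = 0\<^sub>v m"
      using syndrome_class_weight_eq_0_iff[OF B sB] syndrome_class_weight_eq_0_iff[OF B tB] w by simp
    moreover have "s \<in> column_multiples H_B \<longleftrightarrow> t \<in> column_multiples H_B"
      using syndrome_class_weight_eq_1_iff[OF B sB nzB] syndrome_class_weight_eq_1_iff[OF B tB nzB] w by simp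
    ultimately show ?thesis
      using A0[OF sc] A0[OF tc] mult_B[OF sc] mult_B[OF tc] A2[OF sc] A2[OF tc] by arith
  qed
  have "syndrome_class H_A s \<in> code_cosets a (mat_kernel H_A)"
    "syndrome_class H_A t \<in> code_cosets a (mat_kernel H_A)"
    unfolding code_cosets_kernel[OF A] surj using sc tc by auto
  then obtain \<pi> where \<pi>: "\<pi> \<in> carrier (Aut_code a (mat_kernel H_A))"
    "\<pi> ` syndrome_class H_A s = syndrome_class H_A t"
    using ct wA unfolding completely_transitive_iff by blast
  obtain \<sigma> \<phi> where \<phi>: "semilinear_map \<sigma> m m \<phi>"
    and img: "\<And>s. s \<in> carrier_vec m \<Longrightarrow> \<pi> ` syndrome_class H_A s = syndrome_class H_A (\<phi> s)"
    and wt: "\<And>s. s \<in> carrier_vec m \<Longrightarrow> ?wA (\<phi> s) = ?wA s"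
    using Aut_code_induces_syndrome_map[OF A surj \<pi>(1)] by metis
  note F = semilinear_mapD[OF \<phi>]
  have \<phi>s: "\<phi> s = t"
  proof -
    have "t \<in> (*\<^sub>v) H_A ` carrier_vec a" using tc surj by simp
    then obtain z where "z \<in> syndrome_class H_A t" using A unfolding syndrome_class_def by auto
    moreover from this have "z \<in> syndrome_class H_A (\<phi> s)" using img[OF sc] \<pi>(2) by simp
    ultimately show ?thesis unfolding syndrome_class_def by simp
  qed
  have inj: "inj_on \<phi> (carrier_vec m)"
    by (rule semilinear_map_inj_on[OF \<phi>]) (use A0 wt F(2) in metis)
  have pres: "\<phi> ` column_multiples H_B \<subseteq> column_multiples H_B"
  proof
    fix u assume "u \<in> \<phi> ` column_multiples H_B"
    then obtain v where v: "v \<in> column_multiples H_B" "u = \<phi> v" by auto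
    then have vc: "v \<in> carrier_vec m" using cover by auto
    show "u \<in> column_multiples H_B" using mult_B[OF vc] mult_B[OF F(2)[OF vc]] wt[OF vc] v by simp
  qed
  obtain \<psi> where \<psi>: "\<psi> \<in> carrier (Aut_code b (mat_kernel H_B))"
    "\<And>x. x \<in> carrier_vec b \<Longrightarrow> H_B *\<^sub>v \<psi> x = \<phi> (H_B *\<^sub>v x)"
  proof (rule syndrome_map_lifts_to_Aut_code[OF B _ \<phi> inj pres])
    show "i = j" if "i < b" "j < b" "col H_B i = c \<cdot>\<^sub>v col H_B j" for i j c
      using that by (rule indpt)
  qed (rule that)
  have "\<psi> ` K = L"
    unfolding x(2) y(2) Aut_code_image_syndrome_class[OF B \<psi>(1) x(1)] \<psi>(2)[OF x(1)]
    using \<phi>s unfolding s_def t_def by simp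
  then show "\<exists>\<pi>\<in>carrier (Aut_code b (mat_kernel H_B)). \<pi> ` K = L" using \<psi>(1) by blast
qed

section \<open>Surjectivity from the kernel dimension\<close>

text \<open>
  Finiteness of the subspace is assumed because it yields a finite generating set at once.
\<close>
lemma (in vectorspace) finite_subspace_of_full_dim:
  assumes X: "subspace K X V" and fin: "fin_dim" "finite X"
    and dim: "vectorspace.dim K (vs X) = dim"
  shows "X = carrier V"
proof -
  interpret X: vectorspace K "vs X" using X by (rule subspace_is_vs)
  have sub: "submodule K X V" using X unfolding subspace_def by simp
  have XV: "X \<subseteq> carrier V" using sub unfolding submodule_def by simp
  have "X.gen_set X" using X.in_own_span[of X] X.span_is_subset2[of X] by auto
  then have "X.fin_dim" unfolding X.fin_dim_def using fin(2) by auto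
  then obtain b where b: "finite b" "X.basis b" using X.finite_basis_exists by blast
  then have bX: "b \<subseteq> X" "X.lin_indpt b" "X.span b = X" unfolding X.basis_def by auto
  have "lin_indpt b" "span b = X" using span_li_not_depend[OF bX(1) sub] bX by auto
  moreover have "card b = dim" using X.dim_basis[OF b] dim by simp
  ultimately have "basis b" using dim_li_is_basis[OF fin(1) b(1)] bX(1) XV by auto
  then show ?thesis using \<open>span b = X\<close> unfolding basis_def by simp
qed

lemma mult_mat_vec_surj_if_kernel_dim:
  fixes H :: "'a::{field,finite} mat"
  assumes H: "H \<in> carrier_mat m n" and dim: "int (kernel_dim H) = int n - int m"
  shows "(*\<^sub>v) H ` carrier_vec n = carrier_vec m"
proof -
  interpret N: vec_space "TYPE('a)" n .
  interpret M: vec_space "TYPE('a)" m .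
  interpret H: kernel m n H by unfold_locales (rule H)
  have "(*\<^sub>v) H \<in> module_hom class_ring N.V M.V"
    unfolding module_hom_def
    by (simp add: mult_add_distrib_mat_vec[OF H] mult_mat_vec[OF H] mult_mat_vec_carrier[OF H]
        module_vec_simps class_ring_simps Pi_iff)
  then interpret T: linear_map class_ring N.V M.V "(*\<^sub>v) H"
    by (intro linear_map.intro mod_hom.intro mod_hom_axioms.intro vec_vs vec_module)
  have ker: "T.kerT = mat_kernel H" unfolding T.ker_def mat_kernel[OF H] by auto
  have im: "T.imT = (*\<^sub>v) H ` carrier_vec n" unfolding T.im_def by simp
  have "vectorspace.dim class_ring (M.V\<lparr>carrier := T.imT\<rparr>) + kernel_dim H = n"
    using T.rank_nullity_main(1)[OF N.fin_dim] N.dim_is_n ker by simp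
  then have "vectorspace.dim class_ring (M.V\<lparr>carrier := T.imT\<rparr>) = M.dim" using dim M.dim_is_n by simp
  moreover have "finite T.imT" unfolding im by (simp add: finite_carrier_vec)
  ultimately have "T.imT = carrier_vec m"
    using M.finite_subspace_of_full_dim[OF T.imT_is_subspace M.fin_dim] by simp
  then show ?thesis unfolding im .
qed

section \<open>Columns of the Hamming parity-check matrix\<close>

lemma smult_vec_eq_0_iff:
  fixes c :: "'a::field"
  assumes "v \<in> carrier_vec m"
  shows "c \<cdot>\<^sub>v v = 0\<^sub>v m \<longleftrightarrow> c = 0 \<or> v = 0\<^sub>v m"
  using assms by (auto simp: vec_eq_iff)

text \<open>
  Over a field, dependence of \<open>{u, v}\<close> can be stated with a scalar on one side only.  The condition
  \<open>u \<noteq> v\<close> is essential, as \<open>{u, u}\<close> is a singleton.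
\<close>
lemma lin_dep_pair_iff:
  fixes u v :: "'a::field vec"
  assumes u: "u \<in> carrier_vec m" and v: "v \<in> carrier_vec m"
  shows "module.lin_dep class_ring (module_vec TYPE('a) m) {u, v} \<longleftrightarrow>
    u = 0\<^sub>v m \<or> v = 0\<^sub>v m \<or> (u \<noteq> v \<and> (\<exists>c. u = c \<cdot>\<^sub>v v))"
proof -
  interpret vec_space "TYPE('a)" m .
  have lc1: "lincomb f {w} = f w \<cdot>\<^sub>v w" if "w \<in> carrier_vec m" for f and w :: "'a vec"
    using that by (simp add: lincomb_def)
  have lc2: "lincomb f {u, v} = f u \<cdot>\<^sub>v u + f v \<cdot>\<^sub>v v" if "u \<noteq> v" for f
    using that u v by (simp add: lincomb_def)
  show ?thesis
  proof
    assume "lin_dep {u, v}"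
    then obtain f w where f: "lincomb f {u, v} = 0\<^sub>v m" "w \<in> {u, v}" "f w \<noteq> 0"
      using finite_lin_dep[of "{u, v}"] u v by auto
    show "u = 0\<^sub>v m \<or> v = 0\<^sub>v m \<or> (u \<noteq> v \<and> (\<exists>c. u = c \<cdot>\<^sub>v v))"
    proof (cases "u = v")
      case True
      then show ?thesis using f lc1[OF v, of f] smult_vec_eq_0_iff[OF v, of "f v"] by auto
    next
      case False
      have eq: "f u \<cdot>\<^sub>v u + f v \<cdot>\<^sub>v v = 0\<^sub>v m" using f lc2[OF False] by simp
      show ?thesis
      proof (cases "f u = 0")
        case True
        then have "f v \<cdot>\<^sub>v v = 0\<^sub>v m" using eq u v by (auto simp: vec_eq_iff)
        moreover have "f v \<noteq> 0" using f True by auto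
        ultimately show ?thesis using smult_vec_eq_0_iff[OF v, of "f v"] by simp
      next
        case nz: False
        have "u = (- f v / f u) \<cdot>\<^sub>v v"
        proof (rule eq_vecI)
          fix i assume "i < dim_vec ((- f v / f u) \<cdot>\<^sub>v v)"
          then have i: "i < m" using v by simp
          have "(f u \<cdot>\<^sub>v u + f v \<cdot>\<^sub>v v) $ i = 0" unfolding eq using i by simp
          then have "f u * u $ i + f v * v $ i = 0" using i u v by simp
          then have "f u * u $ i = - (f v * v $ i)" by (simp add: eq_neg_iff_add_eq_0)
          then show "u $ i = ((- f v / f u) \<cdot>\<^sub>v v) $ i" using i v nz by (simp add: field_simps)
        qed (use u v in simp)
        then show ?thesis using False by blast
      qed
    qed
  next
    assume "u = 0\<^sub>v m \<or> v = 0\<^sub>v m \<or> (u \<noteq> v \<and> (\<exists>c. u = c \<cdot>\<^sub>v v))"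
    then consider "0\<^sub>v m \<in> {u, v}" | c where "u \<noteq> v" "u = c \<cdot>\<^sub>v v" by auto
    then show "lin_dep {u, v}"
    proof cases
      case 1
      moreover have "(UNIV :: 'a set) \<noteq> {0}" by (metis UNIV_I singletonD zero_neq_one[where ?'a = 'a])
      ultimately show ?thesis by (intro zero_lin_dep) auto
    next
      case (2 c)
      have "lincomb (\<lambda>w. if w = u then 1 else - c) {u, v} = u + (- c) \<cdot>\<^sub>v v" using lc2[OF 2(1)] 2(1) by simp
      also have "\<dots> = 0\<^sub>v m" using 2(2) v by (auto simp: vec_eq_iff)
      finally show ?thesis by (intro lin_dep_crit[where ?A = "{u, v}" and ?a = "\<lambda>w. if w = u then 1 else - c" and ?v = u]) auto
    qed
  qed
qed

text \<open>
  The last claim is where maximality enters: a nonzero vector that is a multiple of no column could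
  be added to the columns without destroying pairwise independence.
\<close>
lemma hamming_check_mat_columns:
  fixes H :: "'a::{field,finite} mat"
  assumes H: "hamming_check_mat m H"
  shows hamming_check_mat_col_neq_0: "i < dim_col H \<Longrightarrow> col H i \<noteq> 0\<^sub>v m"
    and hamming_check_mat_col_indpt: "i < dim_col H \<Longrightarrow> j < dim_col H \<Longrightarrow> col H i = c \<cdot>\<^sub>v col H j \<Longrightarrow> i = j"
    and hamming_check_mat_columns_cover: "column_multiples H = carrier_vec m - {0\<^sub>v m}"
proof -
  let ?S = "set (cols H)"
  have rows: "dim_row H = m" and dist: "distinct (cols H)" and max: "maximal ?S (pairwise_lin_indpt m)"
    using H unfolding hamming_check_mat_def by auto
  have Sc: "?S \<subseteq> carrier_vec m"
    and ind: "\<And>u v. u \<in> ?S \<Longrightarrow> v \<in> ?S \<Longrightarrow> \<not> module.lin_dep class_ring (module_vec TYPE('a) m) {u, v}"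
    and ext: "\<And>T. ?S \<subseteq> T \<Longrightarrow> pairwise_lin_indpt m T \<Longrightarrow> T = ?S"
    using max unfolding maximal_def pairwise_lin_indpt_def by blast+
  have ind': "u \<noteq> 0\<^sub>v m \<and> (u = v \<or> (\<forall>c. u \<noteq> c \<cdot>\<^sub>v v))" if "u \<in> ?S" "v \<in> ?S" for u v
    using ind[OF that] lin_dep_pair_iff[of u m v] Sc that by blast
  have colS: "col H i \<in> ?S" if "i < dim_col H" for i using that by (metis cols_length cols_nth nth_mem)
  have colE: "\<exists>i<dim_col H. u = col H i" if "u \<in> ?S" for u
    using that by (metis cols_length cols_nth in_set_conv_nth)
  show nz: "col H i \<noteq> 0\<^sub>v m" if "i < dim_col H" for i using ind' colS that by blast
  show "i = j" if "i < dim_col H" "j < dim_col H" "col H i = c \<cdot>\<^sub>v col H j" for i j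
  proof -
    have "col H i = col H j" using ind' colS that by blast
    then show ?thesis using dist that by (metis cols_length cols_nth nth_eq_iff_index_eq)
  qed
  show "column_multiples H = carrier_vec m - {0\<^sub>v m}"
  proof (intro equalityI subsetI)
    fix s assume "s \<in> column_multiples H"
    then obtain c i where c: "c \<noteq> 0" "i < dim_col H" "s = c \<cdot>\<^sub>v col H i" unfolding column_multiples_def by auto
    have "col H i \<in> carrier_vec m" using Sc colS c(2) by blast
    then show "s \<in> carrier_vec m - {0\<^sub>v m}" using c nz[OF c(2)] by (simp add: smult_vec_eq_0_iff)
  next
    fix u :: "'a vec" assume u: "u \<in> carrier_vec m - {0\<^sub>v m}"
    show "u \<in> column_multiples H"
    proof (rule ccontr)
      assume no: "u \<notin> column_multiples H"
      have not_mult: "u \<noteq> c \<cdot>\<^sub>v v" if v: "v \<in> ?S" for c v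
      proof
        assume uv: "u = c \<cdot>\<^sub>v v"
        have "v \<in> carrier_vec m" using Sc v by blast
        then have "c \<noteq> 0" using u uv smult_vec_eq_0_iff[of v m c] by auto
        then show False using no uv colE[OF v] unfolding column_multiples_def by auto
      qed
      have uS: "u \<notin> ?S" using not_mult[of u 1] by auto
      have not_scaled: "v \<noteq> c \<cdot>\<^sub>v u" if v: "v \<in> ?S" for c v
      proof
        assume vu: "v = c \<cdot>\<^sub>v u"
        have cnz: "c \<noteq> 0" using ind'[OF v v] u vu smult_vec_eq_0_iff[of u m c] by auto
        have "u = inverse c \<cdot>\<^sub>v v" using vu cnz by (simp add: smult_smult_assoc)
        then show False using not_mult[OF v] by blast
      qed
      have "pairwise_lin_indpt m (insert u ?S)"
        unfolding pairwise_lin_indpt_def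
      proof (intro conjI ballI)
        show sub: "insert u ?S \<subseteq> carrier_vec m" using u Sc by auto
        fix x y :: "'a vec" assume x: "x \<in> insert u ?S" and y: "y \<in> insert u ?S"
        have "x \<noteq> 0\<^sub>v m" "y \<noteq> 0\<^sub>v m" using x y ind' u by auto
        moreover have "x = y \<or> (\<forall>c. x \<noteq> c \<cdot>\<^sub>v y)"
        proof (cases "x = u"; cases "y = u")
          assume "x = u" "y \<noteq> u"
          then show ?thesis using not_mult y by simp
        next
          assume "x \<noteq> u" "y = u"
          then show ?thesis using not_scaled x by simp
        next
          assume "x \<noteq> u" "y \<noteq> u"
          then show ?thesis using ind' x y by simp
        qed simp
        ultimately show "\<not> module.lin_dep class_ring (module_vec TYPE('a) m) {x, y}"
          using lin_dep_pair_iff[of x m y] x y sub by blast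
      qed
      then have "insert u ?S = ?S" by (intro ext) auto
      then show False using uS by auto
    qed
  qed
qed

lemma col_cols_submat:
  assumes J: "J \<subseteq> {0..<dim_col H}"
  shows "dim_col (cols_submat H J) = card J" "cols_submat H J \<in> carrier_mat (dim_row H) (card J)"
    "k < card J \<Longrightarrow> pick J k \<in> J \<and> col (cols_submat H J) k = col H (pick J k)"
proof -
  have J': "{j. j < dim_col H \<and> j \<in> J} = J" using J by auto
  show dc: "dim_col (cols_submat H J) = card J" by (simp add: dim_submatrix J')
  show c: "cols_submat H J \<in> carrier_mat (dim_row H) (card J)"
    by (intro carrier_matI) (simp_all add: dim_submatrix J')
  assume k: "k < card J"
  have pk: "pick J k \<in> J" using pick_in_set_le[OF k] .
  have "col (cols_submat H J) k = col H (pick J k)"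
  proof (rule eq_vecI)
    fix i assume "i < dim_vec (col H (pick J k))"
    then have i: "i < dim_row H" by simp
    have "cols_submat H J $$ (i, k) = H $$ (pick UNIV i, pick J k)"
      using i k by (intro submatrix_index) (simp_all add: J')
    then show "col (cols_submat H J) k $ i = col H (pick J k) $ i"
      using i k pk J c dc by (auto simp: pick_UNIV)
  qed (use c in auto)
  then show "pick J k \<in> J \<and> col (cols_submat H J) k = col H (pick J k)" using pk by simp
qed

lemma column_multiples_cols_submat:
  assumes J: "J \<subseteq> {0..<dim_col H}"
  shows "column_multiples (cols_submat H J) = {c \<cdot>\<^sub>v col H j | c j. c \<noteq> 0 \<and> j \<in> J}"
proof (intro equalityI subsetI)
  fix s assume "s \<in> column_multiples (cols_submat H J)"
  then show "s \<in> {c \<cdot>\<^sub>v col H j | c j. c \<noteq> 0 \<and> j \<in> J}"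
    using col_cols_submat[OF J] unfolding column_multiples_def by force
next
  fix s assume "s \<in> {c \<cdot>\<^sub>v col H j | c j. c \<noteq> 0 \<and> j \<in> J}"
  then obtain c j where c: "s = c \<cdot>\<^sub>v col H j" "c \<noteq> 0" "j \<in> J" by auto
  let ?k = "card {a \<in> J. a < j}"
  have "?k < card J" using c(3) J by (intro psubset_card_mono) (auto intro: finite_subset)
  then have "?k < dim_col (cols_submat H J)" "col (cols_submat H J) ?k = col H j"
    using col_cols_submat[OF J] pick_card_in_set[OF c(3)] by simp_all
  then show "s \<in> column_multiples (cols_submat H J)"
    unfolding column_multiples_def using c(1,2) by (intro CollectI exI[of _ c] exI[of _ ?k]) simp
qed

theorem theorem3p6:
  fixes H :: "'a::{field,finite} mat" and m n n_A n_B :: nat and J :: "nat set"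
    and H_A H_B :: "'a mat" and A B :: "'a vec set"
  assumes "m > 1"
    and "hamming_check_mat m H"
    and "n = dim_col H"
    and "J \<subseteq> {0..<n}" and "J \<noteq> {}" and "n_A = card J" and "n_A < n" and "n_B = n - n_A"
    and "H_A = cols_submat H J"
    and "H_B = cols_submat H ({0..<n} - J)"
    and "A = mat_kernel H_A"
    and "B = mat_kernel H_B"
    and "completely_transitive n_A A"
    and "int (kernel_dim H_A) = int n_A - int m"
    and "covering_radius n_A A = 2"
  shows "completely_transitive n_B B"
proof -
  note sub = \<open>J \<subseteq> {0..<n}\<close>
  let ?J' = "{0..<n} - J"
  have rows: "dim_row H = m" using \<open>hamming_check_mat m H\<close> unfolding hamming_check_mat_def by auto
  have J: "J \<subseteq> {0..<dim_col H}" and J': "?J' \<subseteq> {0..<dim_col H}" using sub \<open>n = dim_col H\<close> by auto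
  have nB: "n_B = card ?J'"
    using sub \<open>n_A = card J\<close> \<open>n_B = n - n_A\<close> by (simp add: card_Diff_subset finite_subset)
  have HA: "H_A \<in> carrier_mat m n_A"
    using col_cols_submat(2)[OF J] rows \<open>H_A = cols_submat H J\<close> \<open>n_A = card J\<close> by simp
  have HB: "H_B \<in> carrier_mat m n_B"
    using col_cols_submat(2)[OF J'] rows \<open>H_B = cols_submat H ({0..<n} - J)\<close> nB by simp
  note col_indpt = hamming_check_mat_col_indpt[OF \<open>hamming_check_mat m H\<close>]
  have colsA: "column_multiples H_A = {c \<cdot>\<^sub>v col H j | c j. c \<noteq> 0 \<and> j \<in> J}"
    unfolding \<open>H_A = cols_submat H J\<close> by (rule column_multiples_cols_submat[OF J])
  have colsB: "column_multiples H_B = {c \<cdot>\<^sub>v col H j | c j. c \<noteq> 0 \<and> j \<in> ?J'}"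
    unfolding \<open>H_B = cols_submat H ({0..<n} - J)\<close> by (rule column_multiples_cols_submat[OF J'])
  have surj: "(*\<^sub>v) H_A ` carrier_vec n_A = carrier_vec m"
    using mult_mat_vec_surj_if_kernel_dim[OF HA] \<open>int (kernel_dim H_A) = int n_A - int m\<close> by simp
  have cover: "column_multiples H_A \<union> column_multiples H_B = carrier_vec m - {0\<^sub>v m}"
  proof -
    have "i < dim_col H \<longleftrightarrow> i \<in> J \<or> i \<in> ?J'" for i using sub \<open>n = dim_col H\<close> by auto
    then have "column_multiples H = column_multiples H_A \<union> column_multiples H_B"
      unfolding colsA colsB unfolding column_multiples_def by blast
    then show ?thesis using hamming_check_mat_columns_cover[OF \<open>hamming_check_mat m H\<close>] by simp
  qed
  have disj: "column_multiples H_A \<inter> column_multiples H_B = {}"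
  proof -
    have False if "c \<cdot>\<^sub>v col H i = d \<cdot>\<^sub>v col H j" "c \<noteq> 0" "i \<in> J" "j \<in> ?J'" for c d i j
    proof -
      have "inverse c \<cdot>\<^sub>v (c \<cdot>\<^sub>v col H i) = inverse c \<cdot>\<^sub>v (d \<cdot>\<^sub>v col H j)" using that(1) by simp
      then have "col H i = (inverse c * d) \<cdot>\<^sub>v col H j" using that(2) by (simp add: smult_smult_assoc)
      moreover have "i < dim_col H" "j < dim_col H" using J J' that(3,4) by auto
      ultimately have "i = j" using col_indpt by blast
      then show False using that(3,4) by simp
    qed
    then show ?thesis unfolding colsA colsB by blast
  qed
  have indpt: "k = l" if k: "k < n_B" and l: "l < n_B" and eq: "col H_B k = c \<cdot>\<^sub>v col H_B l" for k l c
  proof -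
    have K: "pick ?J' k \<in> ?J' \<and> col H_B k = col H (pick ?J' k)"
      and L: "pick ?J' l \<in> ?J' \<and> col H_B l = col H (pick ?J' l)"
      using col_cols_submat(3)[OF J'] k l nB \<open>H_B = cols_submat H ({0..<n} - J)\<close> by auto
    moreover have "pick ?J' k < dim_col H" "pick ?J' l < dim_col H" using K L J' by auto
    ultimately have "pick ?J' k = pick ?J' l" using col_indpt[of "pick ?J' k" "pick ?J' l" c] eq by simp
    then show ?thesis using pick_mono_le[of k ?J' l] pick_mono_le[of l ?J' k] k l nB
      by (cases k l rule: linorder_cases) simp_all
  qed
  have A: "completely_transitive n_A (mat_kernel H_A)" "covering_radius n_A (mat_kernel H_A) = 2"
    using \<open>completely_transitive n_A A\<close> \<open>covering_radius n_A A = 2\<close>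
    unfolding \<open>A = mat_kernel H_A\<close> .
  show ?thesis
    unfolding \<open>B = mat_kernel H_B\<close>
    by (rule completely_transitive_complementary_columns[OF HA HB cover disj _ surj A]) (rule indpt)
qed

end
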